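(* Let $\mathcal{K}=(\mathcal{T},\mathcal{A})$ be a TDL-Lite knowledge base, let $\mathcal{K}^{\ddagger}$ be its $\mathrm{LTL}_P$ translation (a propositional temporal formula with past and future operators, interpreted over $\mathbb{Z}$), and let $\mathcal{K}^{\ddagger_{\mathbb{N}}}$ be the pure-future translation of $\mathcal{K}^{\ddagger}$ (an $\mathrm{LTL}$ formula, interpreted over $\mathbb{N}$). Then $\mathcal{K}^{\ddagger}$ is satisfiable (over $\mathbb{Z}$) if and only if $\mathcal{K}^{\ddagger_{\mathbb{N}}}$ is satisfiable (over $\mathbb{N}$).
   Context: **Propositional temporal logics.** $\mathrm{LTL}_P$ formulas are built from propositional variables and $\bot$ using $\neg$, $\wedge$ and the unary temporal operators $\bigcirc_F,\bigcirc_P,\Diamond_F,\Diamond_P$; the other Boolean connectives are the usual abbreviations, $\Box_F\psi:=\neg\Diamond_F\neg\psi$, and $\Box_P\psi:=\neg\Diamond_P\neg\psi$. For $n\ge 0$, $\bigcirc^n$ is $n$-fold $\bigcirc_F$; for $n<0$, $\bigcirc^n$ is $|n|$-fold $\bigcirc_P$. An interpretation $\mathfrak{M}$ over $\mathbb{Z}$ assigns to every $n\in\mathbb{Z}$ a truth assignment to the propositional variables; $\mathfrak{M},n\models\psi$ is defined with the usual Boolean clauses and: $\mathfrak{M},n\models\bigcirc_F\psi$ iff $\mathfrak{M},n+1\models\psi$; $\mathfrak{M},n\models\bigcirc_P\psi$ iff $\mathfrak{M},n-1\models\psi$; $\mathfrak{M},n\models\Diamond_F\psi$ iff $\mathfrak{M},m\models\psi$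 for some $m\ge n$; $\mathfrak{M},n\models\Diamond_P\psi$ iff $\mathfrak{M},m\models\psi$ for some $m\le n$ (non-strict semantics). An $\mathrm{LTL}_P$ formula $\varphi$ is satisfiable if $\mathfrak{M},0\models\varphi$ for some $\mathfrak{M}$ over $\mathbb{Z}$. $\mathrm{LTL}$ formulas use only $\bigcirc_F,\Diamond_F$ (and $\Box_F$) and are interpreted over $\mathbb{N}$ in the same way; satisfiable means true at time $0$ in some interpretation over $\mathbb{N}$. **TDL-Lite knowledge bases.** Fix countable sets of concept names, individual names, and disjoint sets $\mathsf{N_G}$ (global) and $\mathsf{N_L}$ (local) of role names. A role is a role name $S$ or its inverse $S^-$; $\mathrm{inv}(S)=S^-$, $\mathrm{inv}(S^-)=S$; an inverse role is global iff its role name is. Concepts: $C ::= \bot\mid A\mid\ \ge q\,R\mid\neg C\mid C_1\sqcap C_2\mid\Diamond_F C\mid\Diamond_P C\mid\bigcirc_F C\mid\bigcirc_P C$, with $A$ a concept name, $R$ a role, $q\ge 1$ an integer; $\exists R$ is $\ge 1\,R$. A TBox $\mathcal{T}$ is a finite set of inclusions $C_1\sqsubseteq C_2$; an ABox $\mathcal{A}$ is a finite set of assertions $\bigcirc^nA(a)$, $\bigcirc^n\neg A(a)$, $\bigcirc^nS(a,b)$, $\bigcirc^n\neg S(a,b)$ ($A$ a concept name, $S$ a role name, $a,b$ individual names, $n\in\mathbb{Z}$). A knowledge base is a pair $\mathcal{K}=(\mathcal{T},\mathcal{A})$. It is assumed that $\bigcirc^nS(a,b)\in\mathcal{A}$ implies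 that $\bigcirc^nS^-(b,a)$ is also in $\mathcal{A}$. **The formula $\mathcal{K}^{\ddagger}$.** Concepts translate to one-variable formulas: $A^*=A(x)$, $\bot^*=\bot$, $(\ge q\,R)^*=E_qR(x)$ with $E_qR$ a unary predicate, and $^*$ commutes with $\neg$, $\sqcap$ (translated as $\wedge$) and the temporal operators. Let $\mathsf{role}_{\mathcal{K}}$ be the set of role names occurring in $\mathcal{K}$ together with their inverses, and $Q_{\mathcal{T}}$ the set consisting of $1$ and all numbers occurring in $\mathcal{T}$. Let $\varphi(x)$ be the conjunction of: $C_1^*(x)\to C_2^*(x)$ for all $C_1\sqsubseteq C_2$ in $\mathcal{T}$; $E_{q'}R(x)\to E_qR(x)$ for all $R\in\mathsf{role}_{\mathcal{K}}$ and $q,q'\in Q_{\mathcal{T}}$ with $q'>q$; and $E_qR(x)\to\Box_F\Box_P E_qR(x)$ for all global $R\in\mathsf{role}_{\mathcal{K}}$ and $q\in Q_{\mathcal{T}}$. For a role $R$ and $n\in\mathbb{Z}$ let $\mathcal{A}_n^R=\{R(a,b)\mid\bigcirc^mR(a,b)\in\mathcal{A}\text{ for some }m\in\mathbb{Z}\}$ if $R$ is global and $\mathcal{A}_n^R=\{R(a,b)\mid\bigcirc^nR(a,b)\in\mathcal{A}\}$ if $R$ is local; let $q^{R,n}_{\mathcal{A}(a)}$ be the maximum of $1$ and the number of distinct $b$ with $R(a,b)\in\mathcal{A}^R_n$. Let $$\mathcal{A}^\dagger=\Phi_{\mathcal{A}}\ \wedge\bigwedge_{\bigcirc^nR(a,b)\in\mathcal{A}}\bigcirc^nE_{q}R(a)\big|_{q=q^{R,n}_{\mathcal{A}(a)}}\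 \wedge\bigwedge_{\bigcirc^n\neg S(a,b)\in\mathcal{A},\ S(a,b)\in\mathcal{A}^S_n}\bot,$$ where $\Phi_{\mathcal{A}}$ is the conjunction of all concept assertions in $\mathcal{A}$. For each $R\in\mathsf{role}_{\mathcal{K}}$ take a fresh constant $d_R$ and a fresh propositional variable $p_R$, and consider $$\Box_F\Box_P\forall x\,\varphi(x)\ \wedge\bigwedge_{R\in\mathsf{role}_{\mathcal{K}}}\Big[\Box_F\Box_P\forall x\,\big(E_1R(x)\to\Box_F\Box_P p_R\big)\wedge\big(p_{\mathrm{inv}(R)}\to E_1R(d_R)\big)\Big]\ \wedge\ \mathcal{A}^\dagger .$$ $\mathcal{K}^{\ddagger}$ is the $\mathrm{LTL}_P$ formula obtained by replacing each $\forall x\,\theta(x)$ by the conjunction of $\theta(c)$ over all constants $c$ in this formula, and regarding each ground atom as a propositional variable. **The pure-future translation.** Let $\mathrm{sub}(\mathcal{K}^{\ddagger})$ be the set of subformulas of $\mathcal{K}^{\ddagger}$ (with abbreviations expanded). The alphabet $\Sigma_{\mathcal{K}^{\ddagger_{\mathbb{N}}}}$ has two propositional variables $A_+,A_-$ for each propositional variable $A\in\mathrm{sub}(\mathcal{K}^{\ddagger})$ and two propositional variables $A_+^{\mathbb{O}\psi},A_-^{\mathbb{O}\psi}$ for each temporal formula $\mathbb{O}\psi\in\mathrm{sub}(\mathcal{K}^{\ddagger})$, $\mathbb{O}\in\{\bigcirc_F,\bigcirc_P,\Diamond_F,\Diamond_P\}$. For $\xi\in\mathrm{sub}(\mathcal{K}^{\ddagger})$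 and $\ast\in\{+,-\}$, define the propositional formula $\overline{\xi}_\ast$ by: $\overline{A}_\ast=A_\ast$, $\overline{\bot}_\ast=\bot$, $\overline{\neg\psi}_\ast=\neg\overline{\psi}_\ast$, $\overline{\psi\wedge\phi}_\ast=\overline{\psi}_\ast\wedge\overline{\phi}_\ast$, $\overline{\mathbb{O}\psi}_\ast=A_\ast^{\mathbb{O}\psi}$. Then $$\mathcal{K}^{\ddagger_{\mathbb{N}}}:=\overline{\mathcal{K}^{\ddagger}}_+\wedge\bigwedge_{\overline{\xi}_+\in\Sigma_{\mathcal{K}^{\ddagger_{\mathbb{N}}}}}(\overline{\xi}_+\leftrightarrow\overline{\xi}_-)\wedge\Box_F\Theta,$$ where $\Theta$ is the conjunction of the following formulas, for all formulas of the indicated form in $\mathrm{sub}(\mathcal{K}^{\ddagger})$: - for $\bigcirc_F\psi$: $(\bigcirc_F\overline{\bigcirc_F\psi}_-\leftrightarrow\overline{\psi}_-)\wedge(\overline{\bigcirc_F\psi}_+\leftrightarrow\bigcirc_F\overline{\psi}_+)$; - for $\bigcirc_P\psi$: $(\bigcirc_F\overline{\bigcirc_P\psi}_+\leftrightarrow\overline{\psi}_+)\wedge(\overline{\bigcirc_P\psi}_-\leftrightarrow\bigcirc_F\overline{\psi}_-)$; - for $\Diamond_F\psi$: $(\bigcirc_F\overline{\Diamond_F\psi}_-\leftrightarrow(\overline{\Diamond_F\psi}_-\vee\bigcirc_F\overline{\psi}_-))\wedge(\overline{\Diamond_F\psi}_+\leftrightarrow\Diamond_F\overline{\psi}_+)$;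 - for $\Diamond_P\psi$: $(\bigcirc_F\overline{\Diamond_P\psi}_+\leftrightarrow(\overline{\Diamond_P\psi}_+\vee\bigcirc_F\overline{\psi}_+))\wedge(\overline{\Diamond_P\psi}_-\leftrightarrow\Diamond_F\overline{\psi}_-)$. *)

theory Defs
  imports Main "HOL-Library.Countable"
begin

section \<open>Finite conjunctions\<close>

text \<open>The formula languages below only have binary conjunction. A conjunction indexed by a finite
  set is taken along a fixed but arbitrary enumeration of the index set without repetitions; the
  empty conjunction is truth.\<close>

definition listing :: "'a set \<Rightarrow> 'a list" where
  "listing S = (SOME xs. set xs = S \<and> distinct xs)"

lemma listing: "finite S \<Longrightarrow> set (listing S) = S \<and> distinct (listing S)"
  unfolding listing_def using finite_distinct_list by (rule someI_ex)

fun conj_list :: "('f \<Rightarrow> 'f \<Rightarrow> 'f) \<Rightarrow> 'f \<Rightarrow> 'f list \<Rightarrow> 'f" where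
  "conj_list con tru [] = tru"
| "conj_list con tru [x] = x"
| "conj_list con tru (x # y # xs) = con x (conj_list con tru (y # xs))"

definition conj_over :: "('f \<Rightarrow> 'f \<Rightarrow> 'f) \<Rightarrow> 'f \<Rightarrow> 'i set \<Rightarrow> ('i \<Rightarrow> 'f) \<Rightarrow> 'f" where
  "conj_over con tru S f = conj_list con tru (map f (listing S))"


section \<open>Propositional temporal logics\<close>

datatype 'p ltlp =
    PVar 'p
  | PBot
  | PNeg "'p ltlp"
  | PAnd "'p ltlp" "'p ltlp"
  | PNextF "'p ltlp"
  | PNextP "'p ltlp"
  | PDiaF "'p ltlp"
  | PDiaP "'p ltlp"

fun holds_Z :: "(int \<Rightarrow> 'p \<Rightarrow> bool) \<Rightarrow> int \<Rightarrow> 'p ltlp \<Rightarrow> bool" where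
  "holds_Z M n (PVar p) \<longleftrightarrow> M n p"
| "holds_Z M n PBot \<longleftrightarrow> False"
| "holds_Z M n (PNeg \<psi>) \<longleftrightarrow> \<not> holds_Z M n \<psi>"
| "holds_Z M n (PAnd \<psi> \<phi>) \<longleftrightarrow> holds_Z M n \<psi> \<and> holds_Z M n \<phi>"
| "holds_Z M n (PNextF \<psi>) \<longleftrightarrow> holds_Z M (n + 1) \<psi>"
| "holds_Z M n (PNextP \<psi>) \<longleftrightarrow> holds_Z M (n - 1) \<psi>"
| "holds_Z M n (PDiaF \<psi>) \<longleftrightarrow> (\<exists>m\<ge>n. holds_Z M m \<psi>)"
| "holds_Z M n (PDiaP \<psi>) \<longleftrightarrow> (\<exists>m\<le>n. holds_Z M m \<psi>)"

definition satisfiable_Z :: "'p ltlp \<Rightarrow> bool" where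
  "satisfiable_Z \<phi> \<longleftrightarrow> (\<exists>M. holds_Z M 0 \<phi>)"

abbreviation PConj :: "'i set \<Rightarrow> ('i \<Rightarrow> 'p ltlp) \<Rightarrow> 'p ltlp" where
  "PConj S f \<equiv> conj_over PAnd (PNeg PBot) S f"

fun sub :: "'p ltlp \<Rightarrow> 'p ltlp set" where
  "sub (PVar p) = {PVar p}"
| "sub PBot = {PBot}"
| "sub (PNeg \<psi>) = insert (PNeg \<psi>) (sub \<psi>)"
| "sub (PAnd \<psi> \<phi>) = insert (PAnd \<psi> \<phi>) (sub \<psi> \<union> sub \<phi>)"
| "sub (PNextF \<psi>) = insert (PNextF \<psi>) (sub \<psi>)"
| "sub (PNextP \<psi>) = insert (PNextP \<psi>) (sub \<psi>)"
| "sub (PDiaF \<psi>) = insert (PDiaF \<psi>) (sub \<psi>)"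
| "sub (PDiaP \<psi>) = insert (PDiaP \<psi>) (sub \<psi>)"

fun temporal :: "'p ltlp \<Rightarrow> bool" where
  "temporal (PNextF \<psi>) = True"
| "temporal (PNextP \<psi>) = True"
| "temporal (PDiaF \<psi>) = True"
| "temporal (PDiaP \<psi>) = True"
| "temporal _ = False"

datatype 'p ltl =
    LVar 'p
  | LBot
  | LNeg "'p ltl"
  | LAnd "'p ltl" "'p ltl"
  | LNextF "'p ltl"
  | LDiaF "'p ltl"

fun holds_N :: "(nat \<Rightarrow> 'p \<Rightarrow> bool) \<Rightarrow> nat \<Rightarrow> 'p ltl \<Rightarrow> bool" where
  "holds_N M n (LVar p) \<longleftrightarrow> M n p"
| "holds_N M n LBot \<longleftrightarrow> False"
| "holds_N M n (LNeg \<psi>) \<longleftrightarrow> \<not> holds_N M n \<psi>"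
| "holds_N M n (LAnd \<psi> \<phi>) \<longleftrightarrow> holds_N M n \<psi> \<and> holds_N M n \<phi>"
| "holds_N M n (LNextF \<psi>) \<longleftrightarrow> holds_N M (n + 1) \<psi>"
| "holds_N M n (LDiaF \<psi>) \<longleftrightarrow> (\<exists>m\<ge>n. holds_N M m \<psi>)"

definition satisfiable_N :: "'p ltl \<Rightarrow> bool" where
  "satisfiable_N \<phi> \<longleftrightarrow> (\<exists>M. holds_N M 0 \<phi>)"

abbreviation LOr :: "'p ltl \<Rightarrow> 'p ltl \<Rightarrow> 'p ltl" where
  "LOr \<psi> \<phi> \<equiv> LNeg (LAnd (LNeg \<psi>) (LNeg \<phi>))"

abbreviation LImp :: "'p ltl \<Rightarrow> 'p ltl \<Rightarrow> 'p ltl" where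
  "LImp \<psi> \<phi> \<equiv> LNeg (LAnd \<psi> (LNeg \<phi>))"

abbreviation LIff :: "'p ltl \<Rightarrow> 'p ltl \<Rightarrow> 'p ltl" where
  "LIff \<psi> \<phi> \<equiv> LAnd (LImp \<psi> \<phi>) (LImp \<phi> \<psi>)"

abbreviation LBoxF :: "'p ltl \<Rightarrow> 'p ltl" where
  "LBoxF \<psi> \<equiv> LNeg (LDiaF (LNeg \<psi>))"

abbreviation LConj :: "'i set \<Rightarrow> ('i \<Rightarrow> 'p ltl) \<Rightarrow> 'p ltl" where
  "LConj S f \<equiv> conj_over LAnd (LNeg LBot) S f"


section \<open>TDL-Lite knowledge bases\<close>

text \<open>The constructors keep global and local role names disjoint.\<close>

datatype ('g, 'l) role_name = Global 'g | Local 'l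

datatype ('g, 'l) role = Dir "('g, 'l) role_name" | Inv "('g, 'l) role_name"

fun inv_role :: "('g, 'l) role \<Rightarrow> ('g, 'l) role" where
  "inv_role (Dir S) = Inv S"
| "inv_role (Inv S) = Dir S"

fun name_of :: "('g, 'l) role \<Rightarrow> ('g, 'l) role_name" where
  "name_of (Dir S) = S"
| "name_of (Inv S) = S"

definition global_role :: "('g, 'l) role \<Rightarrow> bool" where
  "global_role R \<longleftrightarrow> (\<exists>g. name_of R = Global g)"

datatype ('c, 'g, 'l) concept =
    CBot
  | CName 'c
  | CGeq nat "('g, 'l) role"
  | CNeg "('c, 'g, 'l) concept"
  | CAnd "('c, 'g, 'l) concept" "('c, 'g, 'l) concept"
  | CDiaF "('c, 'g, 'l) concept"
  | CDiaP "('c, 'g, 'l) concept"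
  | CNextF "('c, 'g, 'l) concept"
  | CNextP "('c, 'g, 'l) concept"

fun concept_role_names :: "('c, 'g, 'l) concept \<Rightarrow> ('g, 'l) role_name set" where
  "concept_role_names CBot = {}"
| "concept_role_names (CName A) = {}"
| "concept_role_names (CGeq q R) = {name_of R}"
| "concept_role_names (CNeg C) = concept_role_names C"
| "concept_role_names (CAnd C D) = concept_role_names C \<union> concept_role_names D"
| "concept_role_names (CDiaF C) = concept_role_names C"
| "concept_role_names (CDiaP C) = concept_role_names C"
| "concept_role_names (CNextF C) = concept_role_names C"
| "concept_role_names (CNextP C) = concept_role_names C"

fun concept_numbers :: "('c, 'g, 'l) concept \<Rightarrow> nat set" where
  "concept_numbers CBot = {}"
| "concept_numbers (CName A) = {}"
| "concept_numbers (CGeq q R) = {q}"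
| "concept_numbers (CNeg C) = concept_numbers C"
| "concept_numbers (CAnd C D) = concept_numbers C \<union> concept_numbers D"
| "concept_numbers (CDiaF C) = concept_numbers C"
| "concept_numbers (CDiaP C) = concept_numbers C"
| "concept_numbers (CNextF C) = concept_numbers C"
| "concept_numbers (CNextP C) = concept_numbers C"

type_synonym ('c, 'g, 'l) tbox = "(('c, 'g, 'l) concept \<times> ('c, 'g, 'l) concept) set"

text \<open>A pair \<open>(C, D)\<close> in a TBox stands for the inclusion of \<open>C\<close> in \<open>D\<close>. The integer in an assertion is
  its time stamp. Positive role assertions are formed with roles rather than role names, because
  ABoxes are assumed to be closed under passing to the inverse role.\<close>

datatype ('c, 'g, 'l, 'i) assertion =
    CPosA int 'c 'i
  | CNegA int 'c 'i
  | RPosA int "('g, 'l) role" 'i 'i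
  | RNegA int "('g, 'l) role_name" 'i 'i

type_synonym ('c, 'g, 'l, 'i) abox = "('c, 'g, 'l, 'i) assertion set"

type_synonym ('c, 'g, 'l, 'i) kb = "('c, 'g, 'l) tbox \<times> ('c, 'g, 'l, 'i) abox"

fun assertion_role_names :: "('c, 'g, 'l, 'i) assertion \<Rightarrow> ('g, 'l) role_name set" where
  "assertion_role_names (CPosA n A a) = {}"
| "assertion_role_names (CNegA n A a) = {}"
| "assertion_role_names (RPosA n R a b) = {name_of R}"
| "assertion_role_names (RNegA n S a b) = {S}"

definition tbox_numbers :: "('c, 'g, 'l) tbox \<Rightarrow> nat set" where
  "tbox_numbers T = (\<Union>(C, D)\<in>T. concept_numbers C \<union> concept_numbers D)"

definition kb_role_names :: "('c, 'g, 'l, 'i) kb \<Rightarrow> ('g, 'l) role_name set" where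
  "kb_role_names K =
     (\<Union>(C, D)\<in>fst K. concept_role_names C \<union> concept_role_names D) \<union>
     (\<Union>\<alpha>\<in>snd K. assertion_role_names \<alpha>)"

definition tdl_lite_kb :: "('c, 'g, 'l, 'i) kb \<Rightarrow> bool" where
  "tdl_lite_kb K \<longleftrightarrow>
     finite (fst K) \<and> finite (snd K) \<and>
     (\<forall>q\<in>tbox_numbers (fst K). q \<ge> 1) \<and>
     (\<forall>n R a b. RPosA n R a b \<in> snd K \<longrightarrow> RPosA n (inv_role R) b a \<in> snd K)"


section \<open>One-variable first-order temporal formulas\<close>

datatype 'd trm = X | Cst 'd

text \<open>Atoms over unary predicates \<open>'p\<close>, constants \<open>'d\<close> and propositional variables \<open>'s\<close>.\<close>

datatype ('p, 'd, 's) atom = Pred 'p "'d trm" | Prop 's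

datatype 'a qtl =
    QAtom 'a
  | QBot
  | QNeg "'a qtl"
  | QAnd "'a qtl" "'a qtl"
  | QNextF "'a qtl"
  | QNextP "'a qtl"
  | QDiaF "'a qtl"
  | QDiaP "'a qtl"
  | QAll "'a qtl"

abbreviation QImp :: "'a qtl \<Rightarrow> 'a qtl \<Rightarrow> 'a qtl" where
  "QImp \<psi> \<phi> \<equiv> QNeg (QAnd \<psi> (QNeg \<phi>))"

abbreviation QBoxF :: "'a qtl \<Rightarrow> 'a qtl" where
  "QBoxF \<psi> \<equiv> QNeg (QDiaF (QNeg \<psi>))"

abbreviation QBoxP :: "'a qtl \<Rightarrow> 'a qtl" where
  "QBoxP \<psi> \<equiv> QNeg (QDiaP (QNeg \<psi>))"

abbreviation QConj :: "'i set \<Rightarrow> ('i \<Rightarrow> 'a qtl) \<Rightarrow> 'a qtl" where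
  "QConj S f \<equiv> conj_over QAnd (QNeg QBot) S f"

definition QNext :: "int \<Rightarrow> 'a qtl \<Rightarrow> 'a qtl" where
  "QNext n \<psi> = (if n \<ge> 0 then (QNextF ^^ nat n) \<psi> else (QNextP ^^ nat (- n)) \<psi>)"

fun atom_consts :: "('p, 'd, 's) atom \<Rightarrow> 'd set" where
  "atom_consts (Pred P (Cst c)) = {c}"
| "atom_consts (Pred P X) = {}"
| "atom_consts (Prop s) = {}"

definition consts_of :: "('p, 'd, 's) atom qtl \<Rightarrow> 'd set" where
  "consts_of \<psi> = (\<Union>\<alpha>\<in>set_qtl \<psi>. atom_consts \<alpha>)"

fun inst_atom :: "'d \<Rightarrow> ('p, 'd, 's) atom \<Rightarrow> ('p, 'd, 's) atom" where
  "inst_atom c (Pred P X) = Pred P (Cst c)"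
| "inst_atom c (Pred P (Cst d)) = Pred P (Cst d)"
| "inst_atom c (Prop s) = Prop s"

text \<open>Replace every universal quantifier by the conjunction of the instances over \<open>D\<close>, and read atoms
  as propositional variables. If the argument is closed, only ground atoms remain.\<close>

fun ground :: "'d set \<Rightarrow> ('p, 'd, 's) atom qtl \<Rightarrow> ('p, 'd, 's) atom ltlp" where
  "ground D (QAtom \<alpha>) = PVar \<alpha>"
| "ground D QBot = PBot"
| "ground D (QNeg \<psi>) = PNeg (ground D \<psi>)"
| "ground D (QAnd \<psi> \<phi>) = PAnd (ground D \<psi>) (ground D \<phi>)"
| "ground D (QNextF \<psi>) = PNextF (ground D \<psi>)"
| "ground D (QNextP \<psi>) = PNextP (ground D \<psi>)"
| "ground D (QDiaF \<psi>) = PDiaF (ground D \<psi>)"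
| "ground D (QDiaP \<psi>) = PDiaP (ground D \<psi>)"
| "ground D (QAll \<psi>) = PConj D (\<lambda>c. map_ltlp (inst_atom c) (ground D \<psi>))"


section \<open>The translation of a knowledge base\<close>

text \<open>\<open>PC A\<close> is the predicate of the concept name \<open>A\<close>, and \<open>PE q R\<close> is the predicate \<open>E\<^sub>qR\<close>.
  \<open>Wit R\<close> is the fresh constant \<open>d\<^sub>R\<close>; the fresh propositional variable \<open>p\<^sub>R\<close> is \<open>Prop R\<close>.\<close>

datatype ('c, 'g, 'l) pred = PC 'c | PE nat "('g, 'l) role"

datatype ('g, 'l, 'i) const = Ind 'i | Wit "('g, 'l) role"

type_synonym ('c, 'g, 'l, 'i) kb_atom =
  "(('c, 'g, 'l) pred, ('g, 'l, 'i) const, ('g, 'l) role) atom"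

abbreviation CA :: "'c \<Rightarrow> ('g, 'l, 'i) const trm \<Rightarrow> ('c, 'g, 'l, 'i) kb_atom qtl" where
  "CA A t \<equiv> QAtom (Pred (PC A) t)"

abbreviation EQ :: "nat \<Rightarrow> ('g, 'l) role \<Rightarrow> ('g, 'l, 'i) const trm \<Rightarrow> ('c, 'g, 'l, 'i) kb_atom qtl" where
  "EQ q R t \<equiv> QAtom (Pred (PE q R) t)"

abbreviation PR :: "('g, 'l) role \<Rightarrow> ('c, 'g, 'l, 'i) kb_atom qtl" where
  "PR R \<equiv> QAtom (Prop R)"

fun star :: "('c, 'g, 'l) concept \<Rightarrow> ('c, 'g, 'l, 'i) kb_atom qtl" where
  "star CBot = QBot"
| "star (CName A) = CA A X"
| "star (CGeq q R) = EQ q R X"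
| "star (CNeg C) = QNeg (star C)"
| "star (CAnd C D) = QAnd (star C) (star D)"
| "star (CDiaF C) = QDiaF (star C)"
| "star (CDiaP C) = QDiaP (star C)"
| "star (CNextF C) = QNextF (star C)"
| "star (CNextP C) = QNextP (star C)"

definition roles :: "('c, 'g, 'l, 'i) kb \<Rightarrow> ('g, 'l) role set" where
  "roles K = Dir ` kb_role_names K \<union> Inv ` kb_role_names K"

definition Q_T :: "('c, 'g, 'l) tbox \<Rightarrow> nat set" where
  "Q_T T = insert 1 (tbox_numbers T)"

definition phi :: "('c, 'g, 'l, 'i) kb \<Rightarrow> ('c, 'g, 'l, 'i) kb_atom qtl" where
  "phi K =
     QAnd (QConj (fst K) (\<lambda>(C, D). QImp (star C) (star D)))
    (QAnd (QConj {(R, q, q'). R \<in> roles K \<and> q \<in> Q_T (fst K) \<and> q' \<in> Q_T (fst K) \<and> q' > q}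
                 (\<lambda>(R, q, q'). QImp (EQ q' R X) (EQ q R X)))
          (QConj {(R, q). R \<in> roles K \<and> global_role R \<and> q \<in> Q_T (fst K)}
                 (\<lambda>(R, q). QImp (EQ q R X) (QBoxF (QBoxP (EQ q R X))))))"

text \<open>The set of pairs \<open>(a, b)\<close> with \<open>R(a, b) \<in> \<A>\<close> at time \<open>n\<close>, and the number derived from it.\<close>

definition abox_at :: "('c, 'g, 'l, 'i) abox \<Rightarrow> ('g, 'l) role \<Rightarrow> int \<Rightarrow> ('i \<times> 'i) set" where
  "abox_at A R n =
     (if global_role R then {(a, b). \<exists>m. RPosA m R a b \<in> A} else {(a, b). RPosA n R a b \<in> A})"

definition abox_num :: "('c, 'g, 'l, 'i) abox \<Rightarrow> ('g, 'l) role \<Rightarrow> int \<Rightarrow> 'i \<Rightarrow> nat" where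
  "abox_num A R n a = max 1 (card {b. (a, b) \<in> abox_at A R n})"

definition abox_concepts :: "('c, 'g, 'l, 'i) abox \<Rightarrow> ('c, 'g, 'l, 'i) kb_atom qtl" where
  "abox_concepts A =
     QAnd (QConj {(n, B, a). CPosA n B a \<in> A} (\<lambda>(n, B, a). QNext n (CA B (Cst (Ind a)))))
          (QConj {(n, B, a). CNegA n B a \<in> A} (\<lambda>(n, B, a). QNext n (QNeg (CA B (Cst (Ind a))))))"

definition abox_dagger :: "('c, 'g, 'l, 'i) abox \<Rightarrow> ('c, 'g, 'l, 'i) kb_atom qtl" where
  "abox_dagger A =
     QAnd (abox_concepts A)
    (QAnd (QConj {(n, R, a, b). RPosA n R a b \<in> A}
                 (\<lambda>(n, R, a, b). QNext n (EQ (abox_num A R n a) R (Cst (Ind a)))))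
          (QConj {(n, S, a, b). RNegA n S a b \<in> A \<and> (a, b) \<in> abox_at A (Dir S) n}
                 (\<lambda>_. QBot)))"

definition kb_dagger :: "('c, 'g, 'l, 'i) kb \<Rightarrow> ('c, 'g, 'l, 'i) kb_atom qtl" where
  "kb_dagger K =
     QAnd (QBoxF (QBoxP (QAll (phi K))))
    (QAnd (QConj (roles K)
                 (\<lambda>R. QAnd (QBoxF (QBoxP (QAll (QImp (EQ 1 R X) (QBoxF (QBoxP (PR R)))))))
                           (QImp (PR (inv_role R)) (EQ 1 R (Cst (Wit R))))))
          (abox_dagger (snd K)))"

definition kb_ddagger :: "('c, 'g, 'l, 'i) kb \<Rightarrow> ('c, 'g, 'l, 'i) kb_atom ltlp" where
  "kb_ddagger K = ground (consts_of (kb_dagger K)) (kb_dagger K)"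


section \<open>The pure-future translation\<close>

text \<open>Copy \<open>Plus\<close> at time \<open>n\<close> describes the instant \<open>n\<close> of the integers, copy \<open>Minus\<close> the instant \<open>-n\<close>.\<close>

datatype copy = Plus | Minus

datatype 'p fvar = Copy copy 'p | Surr copy "'p ltlp"

definition Sigma_N :: "'p ltlp \<Rightarrow> 'p fvar set" where
  "Sigma_N \<kappa> = {Copy s A | s A. PVar A \<in> sub \<kappa>} \<union> {Surr s \<psi> | s \<psi>. \<psi> \<in> sub \<kappa> \<and> temporal \<psi>}"

fun bar :: "copy \<Rightarrow> 'p ltlp \<Rightarrow> 'p fvar ltl" where
  "bar s (PVar A) = LVar (Copy s A)"
| "bar s PBot = LBot"
| "bar s (PNeg \<psi>) = LNeg (bar s \<psi>)"
| "bar s (PAnd \<psi> \<phi>) = LAnd (bar s \<psi>) (bar s \<phi>)"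
| "bar s (PNextF \<psi>) = LVar (Surr s (PNextF \<psi>))"
| "bar s (PNextP \<psi>) = LVar (Surr s (PNextP \<psi>))"
| "bar s (PDiaF \<psi>) = LVar (Surr s (PDiaF \<psi>))"
| "bar s (PDiaP \<psi>) = LVar (Surr s (PDiaP \<psi>))"

definition Theta :: "'p ltlp \<Rightarrow> 'p fvar ltl" where
  "Theta \<kappa> =
     LAnd (LConj {\<psi>. PNextF \<psi> \<in> sub \<kappa>} (\<lambda>\<psi>.
             LAnd (LIff (LNextF (bar Minus (PNextF \<psi>))) (bar Minus \<psi>))
                  (LIff (bar Plus (PNextF \<psi>)) (LNextF (bar Plus \<psi>)))))
    (LAnd (LConj {\<psi>. PNextP \<psi> \<in> sub \<kappa>} (\<lambda>\<psi>.
             LAnd (LIff (LNextF (bar Plus (PNextP \<psi>))) (bar Plus \<psi>))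
                  (LIff (bar Minus (PNextP \<psi>)) (LNextF (bar Minus \<psi>)))))
    (LAnd (LConj {\<psi>. PDiaF \<psi> \<in> sub \<kappa>} (\<lambda>\<psi>.
             LAnd (LIff (LNextF (bar Minus (PDiaF \<psi>)))
                        (LOr (bar Minus (PDiaF \<psi>)) (LNextF (bar Minus \<psi>))))
                  (LIff (bar Plus (PDiaF \<psi>)) (LDiaF (bar Plus \<psi>)))))
          (LConj {\<psi>. PDiaP \<psi> \<in> sub \<kappa>} (\<lambda>\<psi>.
             LAnd (LIff (LNextF (bar Plus (PDiaP \<psi>)))
                        (LOr (bar Plus (PDiaP \<psi>)) (LNextF (bar Plus \<psi>))))
                  (LIff (bar Minus (PDiaP \<psi>)) (LDiaF (bar Minus \<psi>)))))))"

definition pure_future :: "'p ltlp \<Rightarrow> 'p fvar ltl" where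
  "pure_future \<kappa> =
     LAnd (bar Plus \<kappa>)
    (LAnd (LConj {\<xi> \<in> sub \<kappa>. bar Plus \<xi> \<in> LVar ` Sigma_N \<kappa>} (\<lambda>\<xi>. LIff (bar Plus \<xi>) (bar Minus \<xi>)))
          (LBoxF (Theta \<kappa>)))"

definition kb_ddagger_N :: "('c, 'g, 'l, 'i) kb \<Rightarrow> ('c, 'g, 'l, 'i) kb_atom fvar ltl" where
  "kb_ddagger_N K = pure_future (kb_ddagger K)"

end

theory Submission
  imports Defs
begin

text \<open>The line of integers is folded at \<open>0\<close>: a model of a formula \<open>\<kappa>\<close> and a model of its
  translation determine each other by letting the copy \<open>Plus\<close> at \<open>n\<close> describe the instant \<open>n\<close> and
  the copy \<open>Minus\<close> the instant \<open>-n\<close>. In the direction from the translation to \<open>\<kappa>\<close>, an induction on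
  the subformula shows that the surrogates have the intended values. An operator that points away
  from \<open>0\<close> is evaluated within one copy, while an operator that points towards \<open>0\<close> is propagated
  outwards by \<open>Theta\<close> from the instant \<open>0\<close>, where the two copies agree.\<close>

lemma holds_N_conj_list:
  fixes xs :: "'a ltl list"
  shows "holds_N M n (conj_list LAnd (LNeg LBot) xs) \<longleftrightarrow> (\<forall>x\<in>set xs. holds_N M n x)"
  by (induction "LAnd :: 'a ltl \<Rightarrow> _" "LNeg LBot :: 'a ltl" xs rule: conj_list.induct) auto

lemma holds_N_LConj:
  "finite S \<Longrightarrow> holds_N M n (LConj S f) \<longleftrightarrow> (\<forall>i\<in>S. holds_N M n (f i))"
  by (simp add: conj_over_def holds_N_conj_list listing)

lemma finite_sub: "finite (sub \<kappa>)"
  by (induction \<kappa>) auto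

lemma sub_refl: "\<psi> \<in> sub \<psi>"
  by (cases \<psi>) auto

lemma sub_trans: "\<psi> \<in> sub \<phi> \<Longrightarrow> \<phi> \<in> sub \<kappa> \<Longrightarrow> \<psi> \<in> sub \<kappa>"
  by (induction \<kappa>) auto

lemma sub_closed:
  "PNeg \<psi> \<in> sub \<kappa> \<Longrightarrow> \<psi> \<in> sub \<kappa>"
  "PAnd \<psi> \<phi> \<in> sub \<kappa> \<Longrightarrow> \<psi> \<in> sub \<kappa>"
  "PAnd \<psi> \<phi> \<in> sub \<kappa> \<Longrightarrow> \<phi> \<in> sub \<kappa>"
  "PNextF \<psi> \<in> sub \<kappa> \<Longrightarrow> \<psi> \<in> sub \<kappa>"
  "PNextP \<psi> \<in> sub \<kappa> \<Longrightarrow> \<psi> \<in> sub \<kappa>"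
  "PDiaF \<psi> \<in> sub \<kappa> \<Longrightarrow> \<psi> \<in> sub \<kappa>"
  "PDiaP \<psi> \<in> sub \<kappa> \<Longrightarrow> \<psi> \<in> sub \<kappa>"
  by (erule sub_trans[rotated], simp add: sub_refl)+

text \<open>Operands of subformulas are subformulas, so each set lies in the finite
  \<open>sub \<kappa>\<close>. Finiteness is what gives the conjunctions in \<open>Theta\<close>
  their meaning.\<close>

lemma finite_operands:
  "finite {\<psi>. PNextF \<psi> \<in> sub \<kappa>}" "finite {\<psi>. PNextP \<psi> \<in> sub \<kappa>}"
  "finite {\<psi>. PDiaF \<psi> \<in> sub \<kappa>}" "finite {\<psi>. PDiaP \<psi> \<in> sub \<kappa>}"
  by (rule finite_subset[OF _ finite_sub[of \<kappa>]], auto dest: sub_closed)+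

text \<open>The semantic reading of \<open>Theta\<close>, with surrogate variables in place of
  \<open>bar\<close> on temporal formulas and without encoded connectives.\<close>

definition Theta_holds :: "(nat \<Rightarrow> 'p fvar \<Rightarrow> bool) \<Rightarrow> 'p ltlp \<Rightarrow> nat \<Rightarrow> bool" where
  "Theta_holds N \<kappa> n \<longleftrightarrow>
     (\<forall>\<psi>. PNextF \<psi> \<in> sub \<kappa> \<longrightarrow>
        (N (Suc n) (Surr Minus (PNextF \<psi>)) \<longleftrightarrow> holds_N N n (bar Minus \<psi>)) \<and>
        (N n (Surr Plus (PNextF \<psi>)) \<longleftrightarrow> holds_N N (Suc n) (bar Plus \<psi>))) \<and>
     (\<forall>\<psi>. PNextP \<psi> \<in> sub \<kappa> \<longrightarrow>
        (N (Suc n) (Surr Plus (PNextP \<psi>)) \<longleftrightarrow> holds_N N n (bar Plus \<psi>)) \<and>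
        (N n (Surr Minus (PNextP \<psi>)) \<longleftrightarrow> holds_N N (Suc n) (bar Minus \<psi>))) \<and>
     (\<forall>\<psi>. PDiaF \<psi> \<in> sub \<kappa> \<longrightarrow>
        (N (Suc n) (Surr Minus (PDiaF \<psi>)) \<longleftrightarrow>
           N n (Surr Minus (PDiaF \<psi>)) \<or> holds_N N (Suc n) (bar Minus \<psi>)) \<and>
        (N n (Surr Plus (PDiaF \<psi>)) \<longleftrightarrow> (\<exists>m\<ge>n. holds_N N m (bar Plus \<psi>)))) \<and>
     (\<forall>\<psi>. PDiaP \<psi> \<in> sub \<kappa> \<longrightarrow>
        (N (Suc n) (Surr Plus (PDiaP \<psi>)) \<longleftrightarrow>
           N n (Surr Plus (PDiaP \<psi>)) \<or> holds_N N (Suc n) (bar Plus \<psi>)) \<and>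
        (N n (Surr Minus (PDiaP \<psi>)) \<longleftrightarrow> (\<exists>m\<ge>n. holds_N N m (bar Minus \<psi>))))"

lemma holds_N_Theta: "holds_N N n (Theta \<kappa>) \<longleftrightarrow> Theta_holds N \<kappa> n"
  unfolding Theta_def Theta_holds_def holds_N.simps bar.simps
    holds_N_LConj[OF finite_operands(1)] holds_N_LConj[OF finite_operands(2)]
    holds_N_LConj[OF finite_operands(3)] holds_N_LConj[OF finite_operands(4)]
    Ball_def mem_Collect_eq Suc_eq_plus1
  by (intro arg_cong2[where f = "(\<and>)"] iff_allI imp_cong refl) blast+

text \<open>The outermost constructor of \<open>\<xi>\<close> decides: \<open>bar Plus\<close>
  yields a variable only on propositional variables and temporal formulas.\<close>

lemma bar_Plus_in_Sigma_N:
  "{\<xi> \<in> sub \<kappa>. bar Plus \<xi> \<in> LVar ` Sigma_N \<kappa>} =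
     {\<xi> \<in> sub \<kappa>. temporal \<xi> \<or> (\<exists>A. \<xi> = PVar A)}" (is "?L = ?R")
proof -
  have "\<xi> \<in> ?L \<longleftrightarrow> \<xi> \<in> ?R" for \<xi>
    by (cases \<xi>) (auto simp: Sigma_N_def)
  then show ?thesis by blast
qed

lemma holds_N_pure_future:
  "holds_N N 0 (pure_future \<kappa>) \<longleftrightarrow>
     holds_N N 0 (bar Plus \<kappa>) \<and>
     (\<forall>\<xi>\<in>sub \<kappa>. temporal \<xi> \<or> (\<exists>A. \<xi> = PVar A) \<longrightarrow>
        (holds_N N 0 (bar Plus \<xi>) \<longleftrightarrow> holds_N N 0 (bar Minus \<xi>))) \<and>
     (\<forall>n. Theta_holds N \<kappa> n)"
  unfolding pure_future_def bar_Plus_in_Sigma_N holds_N.simps holds_N_Theta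
    holds_N_LConj[OF finite_subset[OF Collect_restrict finite_sub]]
  by blast

fun instant :: "copy \<Rightarrow> nat \<Rightarrow> int" where
  "instant Plus n = int n"
| "instant Minus n = - int n"

fun fold_model :: "(int \<Rightarrow> 'p \<Rightarrow> bool) \<Rightarrow> nat \<Rightarrow> 'p fvar \<Rightarrow> bool" where
  "fold_model M n (Copy s A) = M (instant s n) A"
| "fold_model M n (Surr s \<psi>) = holds_Z M (instant s n) \<psi>"

text \<open>Surrogates receive the value of the formula they stand for by definition, so only the
  Boolean cases need the induction hypothesis.\<close>

lemma holds_N_fold_model:
  "holds_N (fold_model M) n (bar s \<psi>) \<longleftrightarrow> holds_Z M (instant s n) \<psi>"
  by (induction \<psi>) auto

lemma ex_ge_int: "(\<exists>m\<ge>int n. P m) \<longleftrightarrow> (\<exists>m\<ge>n. P (int m))"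
proof
  assume "\<exists>m\<ge>int n. P m"
  then obtain m where "int n \<le> m" "P m" by blast
  then have "n \<le> nat m" "P (int (nat m))" by auto
  then show "\<exists>m\<ge>n. P (int m)" by blast
qed (metis of_nat_le_iff)

lemma ex_le_minus_int: "(\<exists>m\<le>- int n. P m) \<longleftrightarrow> (\<exists>m\<ge>n. P (- int m))"
proof
  assume "\<exists>m\<le>- int n. P m"
  then obtain m where "m \<le> - int n" "P m" by blast
  then have "n \<le> nat (- m)" "P (- int (nat (- m)))" by auto
  then show "\<exists>m\<ge>n. P (- int m)" by blast
qed (metis of_nat_le_iff neg_le_iff_le)

text \<open>The expansion law behind the \<open>Theta\<close> clause that carries
  \<open>PDiaF\<close> away from \<open>0\<close> in the copy \<open>Minus\<close>;
  \<open>ex_le_succ\<close> is its mirror image for \<open>PDiaP\<close> and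
  \<open>Plus\<close>.\<close>

lemma ex_ge_pred: "(\<exists>m\<ge>k - 1. P m) \<longleftrightarrow> (\<exists>m\<ge>k. P m) \<or> P (k - 1)" for k :: int
proof -
  have "k - 1 \<le> m \<longleftrightarrow> k \<le> m \<or> m = k - 1" for m by auto
  then show ?thesis by auto
qed

lemma ex_le_succ: "(\<exists>m\<le>k + 1. P m) \<longleftrightarrow> (\<exists>m\<le>k. P m) \<or> P (k + 1)" for k :: int
proof -
  have "m \<le> k + 1 \<longleftrightarrow> m \<le> k \<or> m = k + 1" for m by auto
  then show ?thesis by auto
qed

text \<open>Simplifying \<open>- int (Suc n)\<close> produces the left side;
  \<open>ex_ge_pred\<close> expects the form \<open>k - 1\<close>.\<close>

lemma minus_one_diff: "- 1 - int n = - int n - 1"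
  by simp

lemma Theta_holds_fold_model: "Theta_holds (fold_model M) \<kappa> n"
  unfolding Theta_holds_def
  by (simp add: holds_N_fold_model ex_ge_int[where P = "\<lambda>m. holds_Z M m _"]
      ex_le_minus_int[where P = "\<lambda>m. holds_Z M m _"]
      ex_ge_pred ex_le_succ minus_one_diff add.commute[of 1])

lemma satisfiable_Z_imp_satisfiable_N:
  assumes "satisfiable_Z \<kappa>"
  shows "satisfiable_N (pure_future \<kappa>)"
proof -
  obtain M where "holds_Z M 0 \<kappa>"
    using assms by (auto simp: satisfiable_Z_def)
  then have "holds_N (fold_model M) 0 (pure_future \<kappa>)"
    by (simp add: holds_N_pure_future holds_N_fold_model Theta_holds_fold_model)
  then show ?thesis
    by (auto simp: satisfiable_N_def)
qed

text \<open>Both copies describe the instant \<open>0\<close>; the value there is taken from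
  \<open>Plus\<close>.\<close>

definition unfold_model :: "(nat \<Rightarrow> 'p fvar \<Rightarrow> bool) \<Rightarrow> int \<Rightarrow> 'p \<Rightarrow> bool" where
  "unfold_model N n A =
     (if n \<ge> 0 then N (nat n) (Copy Plus A) else N (nat (- n)) (Copy Minus A))"

lemma holds_Z_unfold_model:
  assumes agree: "\<And>\<xi>. \<xi> \<in> sub \<kappa> \<Longrightarrow> temporal \<xi> \<or> (\<exists>A. \<xi> = PVar A) \<Longrightarrow>
      holds_N N 0 (bar Plus \<xi>) \<longleftrightarrow> holds_N N 0 (bar Minus \<xi>)"
    and Theta: "\<And>n. Theta_holds N \<kappa> n"
    and "\<psi> \<in> sub \<kappa>"
  shows "holds_N N n (bar s \<psi>) \<longleftrightarrow> holds_Z (unfold_model N) (instant s n) \<psi>"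
  using \<open>\<psi> \<in> sub \<kappa>\<close>
proof (induction \<psi> arbitrary: s n)
  case (PVar A)
  show ?case
    \<comment> \<open>Agreement matters for \<open>Minus\<close> at \<open>0\<close>, where
      \<open>unfold_model\<close> reads the other copy.\<close>
    using agree[OF PVar] by (cases s; cases n) (auto simp: unfold_model_def nat_add_distrib)
next
  case (PNeg \<psi>)
  then show ?case by (auto dest: sub_closed)
next
  case (PAnd \<psi> \<phi>)
  then show ?case by (auto dest: sub_closed)
next
  case (PNextF \<psi>)
  note IH = PNextF.IH[OF sub_closed(4)[OF PNextF.prems]]
  have plus: "N n (Surr Plus (PNextF \<psi>)) \<longleftrightarrow> holds_Z (unfold_model N) (int n + 1) \<psi>" for n
    using Theta[of n] PNextF.prems IH[of "Suc n" Plus]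
    by (simp add: Theta_holds_def add.commute)
  show ?case
  proof (cases s)
    case Minus
    show ?thesis
    proof (cases n)
      case 0
      \<comment> \<open>The successor of instant \<open>0\<close> lies in the copy
        \<open>Plus\<close>, so agreement moves the surrogate there.\<close>
      then show ?thesis using Minus agree[OF PNextF.prems] plus[of 0] by simp
    next
      case (Suc k)
      then show ?thesis
        \<comment> \<open>Within \<open>Minus\<close> the next instant after
          \<open>- int (Suc k)\<close> is \<open>- int k\<close>, one step back in the natural
          numbers.\<close>
        using Minus Theta[of k] PNextF.prems IH[of k Minus] by (simp add: Theta_holds_def)
    qed
  qed (simp add: plus)
next
  case (PNextP \<psi>)
  note IH = PNextP.IH[OF sub_closed(5)[OF PNextP.prems]]
  have minus: "N n (Surr Minus (PNextP \<psi>)) \<longleftrightarrow> holds_Z (unfold_model N) (- int n - 1) \<psi>" for n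
    using Theta[of n] PNextP.prems IH[of "Suc n" Minus]
    by (simp add: Theta_holds_def minus_one_diff)
  show ?case
  proof (cases s)
    case Plus
    show ?thesis
    proof (cases n)
      case 0
      then show ?thesis using Plus agree[OF PNextP.prems] minus[of 0] by simp
    next
      case (Suc k)
      then show ?thesis
        using Plus Theta[of k] PNextP.prems IH[of k Plus] by (simp add: Theta_holds_def)
    qed
  qed (simp add: minus)
next
  case (PDiaF \<psi>)
  note IH = PDiaF.IH[OF sub_closed(6)[OF PDiaF.prems]]
  have plus: "N n (Surr Plus (PDiaF \<psi>)) \<longleftrightarrow> holds_Z (unfold_model N) (int n) (PDiaF \<psi>)" for n
    \<comment> \<open>All instants from \<open>int n\<close> on lie in \<open>Plus\<close>, so no
      induction on \<open>n\<close> is needed.\<close>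
    using Theta[of n] PDiaF.prems by (simp add: Theta_holds_def IH ex_ge_int)
  have minus: "N n (Surr Minus (PDiaF \<psi>)) \<longleftrightarrow> holds_Z (unfold_model N) (- int n) (PDiaF \<psi>)" for n
  \<comment> \<open>Agreement and \<open>plus\<close> settle instant \<open>0\<close>; each further
    step outwards adds one instant to the range of the diamond.\<close>
  proof (induction n)
    case 0
    then show ?case using agree[OF PDiaF.prems] plus[of 0] by simp
  next
    case (Suc n)
    then show ?case
      using Theta[of n] PDiaF.prems IH[of "Suc n" Minus]
        ex_ge_pred[of "- int n" "\<lambda>m. holds_Z (unfold_model N) m \<psi>"]
      by (simp add: Theta_holds_def minus_one_diff)
  qed
  show ?case by (cases s) (simp_all add: plus minus)
next
  case (PDiaP \<psi>)
  note IH = PDiaP.IH[OF sub_closed(7)[OF PDiaP.prems]]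
  have minus: "N n (Surr Minus (PDiaP \<psi>)) \<longleftrightarrow> holds_Z (unfold_model N) (- int n) (PDiaP \<psi>)" for n
    using Theta[of n] PDiaP.prems by (simp add: Theta_holds_def IH ex_le_minus_int)
  have plus: "N n (Surr Plus (PDiaP \<psi>)) \<longleftrightarrow> holds_Z (unfold_model N) (int n) (PDiaP \<psi>)" for n
  proof (induction n)
    case 0
    then show ?case using agree[OF PDiaP.prems] minus[of 0] by simp
  next
    case (Suc n)
    then show ?case
      using Theta[of n] PDiaP.prems IH[of "Suc n" Plus]
        ex_le_succ[of "int n" "\<lambda>m. holds_Z (unfold_model N) m \<psi>"]
      by (simp add: Theta_holds_def add.commute)
  qed
  show ?case by (cases s) (simp_all add: plus minus)
qed simp

lemma satisfiable_N_imp_satisfiable_Z: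
  assumes "satisfiable_N (pure_future \<kappa>)"
  shows "satisfiable_Z \<kappa>"
proof -
  obtain N where "holds_N N 0 (pure_future \<kappa>)"
    using assms by (auto simp: satisfiable_N_def)
  then have "holds_Z (unfold_model N) (instant Plus 0) \<kappa>"
    \<comment> \<open>\<open>sub_refl\<close> selects \<open>\<kappa>\<close> itself as the
      subformula.\<close>
    unfolding holds_N_pure_future using holds_Z_unfold_model[OF _ _ sub_refl] by blast
  then show ?thesis
    by (auto simp: satisfiable_Z_def)
qed

theorem theorem7:
  fixes K :: "('c::countable, 'g::countable, 'l::countable, 'i::countable) kb"
  assumes "tdl_lite_kb K"
  shows "satisfiable_Z (kb_ddagger K) \<longleftrightarrow> satisfiable_N (kb_ddagger_N K)"
  unfolding kb_ddagger_N_def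
  using satisfiable_Z_imp_satisfiable_N satisfiable_N_imp_satisfiable_Z by blast

end
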